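(* Consider the online problem and Algorithm VQB described in the context, and assume the standing assumptions there on $\chi$, $(f_t)$, $(\boldsymbol g_t)$ with constants $R,F,G,K$ and $\beta=KG$. Let $\{x_t^*\}_{t=1}^T$ be the sequence of per-slot minimizers, $x_t^*\in\arg\min\{f_t(x): x\in\chi,\ \boldsymbol g_t(x)\le \boldsymbol 0\}$, and set $x_0^*:=x_1^*$. (Case 1) If VQB is run with $$\alpha_t=\sqrt{\frac{T}{R+\sum_{i=1}^{t}\|x_i^*-x_{i-1}^*\|}},\qquad \gamma_t^2=\frac{1}{2\beta^2}\frac{1}{\sqrt{2R}},$$ then $$\mathrm{Regret}\le O\big(\max\{\sqrt{T V_x},\,V_{\boldsymbol g}\}\big),\qquad \mathrm{Vio}_k\le O\big(\max\{\sqrt T,\,V_{\boldsymbol g}\}\big)\quad\text{for all }k=1,\dots,K.$$ (Case 2) If VQB is run with $$\alpha_t=\sqrt{\frac{T}{R+\sum_{i=1}^{t}\|x_i^*-x_{i-1}^*\|}},\qquad \gamma_t^2=\frac{1}{2\beta^2}\frac{1}{\sqrt{2R}}\frac{1}{\sqrt{t+1}},$$ then $$\mathrm{Regret}\le O\big(\sqrt{T V_x}\big),\qquad \mathrm{Vio}_k\le O\big(\max\{T^{3/4},\,V_{\boldsymbol g}\}\big)\quad\text{for all }k=1,\dots,K.$$ Here $O(\cdot)$ is with respect to the time horizon $T$ and hides factors depending only on the constants $R,F,G,K$ of the standing assumptions.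
   Context: Setting. $\|\cdot\|$ is the Euclidean norm; vector inequalities and maxima are componentwise. $\chi\subseteq\mathbb R^n$ is nonempty, closed, convex; for $t=1,\dots,T$, $f_t:\chi\to\mathbb R$ is a loss function and $\boldsymbol g_t=(g_{t,1},\dots,g_{t,K})^T:\chi\to\mathbb R^K$ a vector of constraint functions. For each $t$ the set $\{x\in\chi:\boldsymbol g_t(x)\le\boldsymbol0\}$ is nonempty, so that the minimizers $x_t^*$ exist. Standing assumptions. (i) $\chi$ is compact with $\|x-y\|\le R$ for all $x,y\in\chi$. (ii) All $f_t$ and $g_{t,k}$ are convex, and $\max\{|f_t(x)|,\|\boldsymbol g_t(x)\|\}\le F$ for all $x\in\chi$ and all $t$. (iii) $\max\{\|\nabla f_t(x)\|,\|\nabla g_{t,k}(x)\|\}\le G$ for all $x\in\chi,k,t$; consequently, with $\beta:=KG$, $\|\boldsymbol g_t(x)-\boldsymbol g_t(y)\|\le\beta\|x-y\|$ on $\chi$. Algorithm VQB with positive parameters $(\alpha_t)_{t\ge1}$, $(\gamma_t)_{t\ge0}$. Initialize $\boldsymbol g_0\equiv\boldsymbol 0$, $\boldsymbol\lambda(0)=\boldsymbol0\in\mathbb R^K$, $x_1\in\chi$ arbitrary. For $t=1,\dots,T-1$: $$\boldsymbol\lambda(t)=\max\{\boldsymbol\lambda(t-1)+\gamma_{t-1}\boldsymbol g_{t-1}(x_t),\,-\gamma_{t-1}\boldsymbol g_{t-1}(x_t)\},$$ $$x_{t+1}=\arg\min_{x\in\chi}\ \nabla f_t(x_t)^T(x-x_t)+[\boldsymbol\lambda(t)+\gamma_{t-1}\boldsymbol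 g_{t-1}(x_t)]^T(\gamma_t\boldsymbol g_t(x))+\alpha_t\|x-x_t\|^2 .$$ Performance measures. $\mathrm{Regret}=\sum_{t=1}^Tf_t(x_t)-\sum_{t=1}^Tf_t(x_t^* )$; $\mathrm{Vio}_k=\sum_{t=1}^Tg_{t,k}(x_t)$; $V_x=\sum_{t=2}^T\|x_t^*-x_{t-1}^*\|$; $V_{\boldsymbol g}=\sum_{t=2}^T\sup_{x\in\chi}\|\boldsymbol g_t(x)-\boldsymbol g_{t-1}(x)\|$.
   Formalization: In both regret bounds V_x is replaced by max{R, V_x}, since the bound as written fails when V_x = V_g = 0 (e.g. f_t(x)=x, g_t=0 on [0,1], x_1=1); also R>0 and G>0 are assumed so that the parameters are defined. *)

theory Defs
  imports "HOL-Analysis.Analysis"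
begin

text \<open>
  The decision set lies in a finite-dimensional subspace of an arbitrary real inner product space
  rather than in \<^typ>\<open>real ^ 'n\<close>.  A constant whose existence is asserted for a fixed ambient type
  then serves decision sets of every dimension inside that type; with \<^typ>\<open>real ^ 'n\<close> it could
  depend on the dimension.  The number of constraints is the cardinality of \<^typ>\<open>'k\<close>, and
  inequality on \<^typ>\<open>real ^ 'k\<close> is componentwise.  Rounds are numbered from 1.
\<close>

definition online_problem ::
    "'a::real_inner set \<Rightarrow> (nat \<Rightarrow> 'a \<Rightarrow> real ^ 'k) \<Rightarrow> nat \<Rightarrow> bool" where
  "online_problem X g T \<longleftrightarrow>
     (\<exists>B. finite B \<and> X \<subseteq> span B) \<and> X \<noteq> {} \<and> closed X \<and> convex X \<and>
     (\<forall>t\<in>{1..T}. {x \<in> X. g t x \<le> 0} \<noteq> {})"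

text \<open>
  The gradients \<open>df\<close>, \<open>dg\<close> are arguments because losses and constraints live on \<open>X\<close> only: the
  derivative is taken within \<open>X\<close>, where it need not be unique if \<open>X\<close> has empty interior.
\<close>

definition standing_assumptions ::
    "real \<Rightarrow> real \<Rightarrow> real \<Rightarrow> 'a::real_inner set \<Rightarrow> (nat \<Rightarrow> 'a \<Rightarrow> real) \<Rightarrow> (nat \<Rightarrow> 'a \<Rightarrow> 'a) \<Rightarrow>
     (nat \<Rightarrow> 'a \<Rightarrow> real ^ 'k) \<Rightarrow> (nat \<Rightarrow> 'k \<Rightarrow> 'a \<Rightarrow> 'a) \<Rightarrow> nat \<Rightarrow> bool" where
  "standing_assumptions R F G X f df g dg T \<longleftrightarrow>
     compact X \<and> (\<forall>x\<in>X. \<forall>y\<in>X. norm (x - y) \<le> R) \<and>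
     (\<forall>t\<in>{1..T}.
        convex_on X (f t) \<and> (\<forall>k. convex_on X (\<lambda>x. g t x $ k)) \<and>
        (\<forall>x\<in>X. max \<bar>f t x\<bar> (norm (g t x)) \<le> F) \<and>
        (\<forall>x\<in>X. (f t has_derivative (\<lambda>h. df t x \<bullet> h)) (at x within X) \<and> norm (df t x) \<le> G) \<and>
        (\<forall>k. \<forall>x\<in>X. ((\<lambda>y. g t y $ k) has_derivative (\<lambda>h. dg t k x \<bullet> h)) (at x within X) \<and>
                   norm (dg t k x) \<le> G))"

definition slot_minimizers ::
    "'a set \<Rightarrow> (nat \<Rightarrow> 'a \<Rightarrow> real) \<Rightarrow> (nat \<Rightarrow> 'a \<Rightarrow> real ^ 'k) \<Rightarrow> nat \<Rightarrow> (nat \<Rightarrow> 'a) \<Rightarrow> bool" where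
  "slot_minimizers X f g T xstar \<longleftrightarrow>
     (\<forall>t\<in>{1..T}. is_arg_min (f t) (\<lambda>x. x \<in> X \<and> g t x \<le> 0) (xstar t))"

definition vqb_objective ::
    "('a \<Rightarrow> 'a) \<Rightarrow> (nat \<Rightarrow> 'a \<Rightarrow> real ^ 'k) \<Rightarrow> (nat \<Rightarrow> real) \<Rightarrow> (nat \<Rightarrow> real) \<Rightarrow>
     real ^ 'k \<Rightarrow> 'a::real_inner \<Rightarrow> nat \<Rightarrow> 'a \<Rightarrow> real" where
  "vqb_objective dft g \<alpha> \<gamma> lam xt t x =
     dft xt \<bullet> (x - xt) +
     (lam + \<gamma> (t - 1) *\<^sub>R g (t - 1) xt) \<bullet> (\<gamma> t *\<^sub>R g t x) +
     \<alpha> t * (norm (x - xt))\<^sup>2"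

text \<open>
  The maximum in the virtual queue update is componentwise; \<^const>\<open>max\<close> on \<^typ>\<open>real ^ 'k\<close> would
  not be.
\<close>

definition vqb_run ::
    "'a::real_inner set \<Rightarrow> (nat \<Rightarrow> 'a \<Rightarrow> 'a) \<Rightarrow> (nat \<Rightarrow> 'a \<Rightarrow> real ^ 'k) \<Rightarrow> (nat \<Rightarrow> real) \<Rightarrow>
     (nat \<Rightarrow> real) \<Rightarrow> nat \<Rightarrow> (nat \<Rightarrow> real ^ 'k) \<Rightarrow> (nat \<Rightarrow> 'a) \<Rightarrow> bool" where
  "vqb_run X df g \<alpha> \<gamma> T lam x \<longleftrightarrow>
     (\<forall>y. g 0 y = 0) \<and> lam 0 = 0 \<and> x 1 \<in> X \<and>
     (\<forall>t\<in>{1..<T}.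
        lam t = (\<chi> k. max (lam (t - 1) $ k + \<gamma> (t - 1) * g (t - 1) (x t) $ k)
                          (- (\<gamma> (t - 1) * g (t - 1) (x t) $ k))) \<and>
        is_arg_min (vqb_objective (df t) g \<alpha> \<gamma> (lam t) (x t) t) (\<lambda>y. y \<in> X) (x (t + 1)))"

definition regret ::
    "(nat \<Rightarrow> 'a \<Rightarrow> real) \<Rightarrow> nat \<Rightarrow> (nat \<Rightarrow> 'a) \<Rightarrow> (nat \<Rightarrow> 'a) \<Rightarrow> real" where
  "regret f T xstar x = (\<Sum>t=1..T. f t (x t)) - (\<Sum>t=1..T. f t (xstar t))"

definition violation :: "(nat \<Rightarrow> 'a \<Rightarrow> real ^ 'k) \<Rightarrow> nat \<Rightarrow> (nat \<Rightarrow> 'a) \<Rightarrow> 'k \<Rightarrow> real" where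
  "violation g T x k = (\<Sum>t=1..T. g t (x t) $ k)"

definition path_variation :: "nat \<Rightarrow> (nat \<Rightarrow> 'a::real_normed_vector) \<Rightarrow> real" where
  "path_variation T xstar = (\<Sum>t=2..T. norm (xstar t - xstar (t - 1)))"

definition constraint_variation ::
    "'a set \<Rightarrow> (nat \<Rightarrow> 'a \<Rightarrow> real ^ 'k) \<Rightarrow> nat \<Rightarrow> real" where
  "constraint_variation X g T = (\<Sum>t=2..T. SUP x\<in>X. norm (g t x - g (t - 1) x))"

end

theory Submission
  imports Defs
begin

text \<open>
  The minimizer of a convex function plus \<open>\<alpha> \<parallel>x - x\<^sub>t\<parallel>\<^sup>2\<close> satisfies a three-point inequality.  Comparing
  the new point with \<open>x\<^sub>t\<^sup>*\<close>, where the constraint term is nonpositive, and adding the drift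
  \<open>\<parallel>\<lambda>(t+1)\<parallel>\<^sup>2 - \<parallel>\<lambda>(t)\<parallel>\<^sup>2 \<le> 2 \<lambda>(t) \<bullet> u\<^sub>t + 2 \<parallel>u\<^sub>t\<parallel>\<^sup>2\<close> with \<open>u\<^sub>t = \<gamma>\<^sub>t g\<^sub>t(x\<^sub>t\<^sub>+\<^sub>1)\<close>, bounds the loss difference
  plus the drift by telescoping terms, \<open>G\<^sup>2 / (2 \<alpha>\<^sub>t)\<close> and the squared change of \<open>\<gamma>\<^sub>t g\<^sub>t\<close>.  Summation bounds
  the regret, and, since each loss difference is at least \<open>-2F\<close>, also gives \<open>\<parallel>\<lambda>(T)\<parallel> = O(\<surd>T)\<close>.  The queue
  dominates the accumulated constraint values: by Abel summation
  \<open>\<Sum> g\<^sub>t(x\<^sub>t\<^sub>+\<^sub>1) \<le> \<lambda>(T) / \<gamma>\<^sub>T\<^sub>-\<^sub>1\<close>, and replacing \<open>g\<^sub>t\<close> by \<open>g\<^sub>t\<^sub>+\<^sub>1\<close> costs the variation of the constraints.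
\<close>

section \<open>Convexity and proximal minimization\<close>

text \<open>Move a small fraction \<open>s\<close> of the way from \<open>x\<close> to
  \<open>y\<close>. Convexity bounds \<open>f\<close> there from above by the chord, the derivative
  bounds it from below up to an error proportional to \<open>s\<close>; dividing by \<open>s\<close>
  leaves the tangent inequality up to an arbitrary \<open>e\<close>.\<close>

lemma convex_on_above_derivative:
  fixes f :: "'a::real_normed_vector \<Rightarrow> real"
  assumes conv: "convex_on X f" and der: "(f has_derivative D) (at x within X)"
    and x: "x \<in> X" and y: "y \<in> X"
  shows "f x + D (y - x) \<le> f y"
proof (rule field_le_epsilon)
  fix e :: real assume e: "e > 0"
  define h where "h = y - x"
  \<comment> \<open>The \<open>+ 1\<close> covers \<open>y = x\<close>, and the choice gives
    \<open>e' * norm h \<le> e\<close>.\<close>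
  define e' where "e' = e / (norm h + 1)"
  have hp: "norm h + 1 > 0" using norm_ge_zero[of h] by linarith
  have e': "e' > 0" using e hp by (simp add: e'_def)
  obtain d where d: "d > 0"
    "\<And>z. z \<in> X \<Longrightarrow> norm (z - x) < d \<Longrightarrow> norm (f z - f x - D (z - x)) \<le> e' * norm (z - x)"
    using der e' unfolding has_derivative_within_alt by blast
  define s where "s = min 1 (d / (2 * (norm h + 1)))"
  have s: "0 < s" "s \<le> 1" using d hp by (auto simp: s_def)
  have "s * norm h \<le> d / (2 * (norm h + 1)) * norm h" 
    by (intro mult_right_mono) (auto simp: s_def)
  also have "\<dots> < d" using d hp by (simp add: field_simps) (smt (verit) mult_nonneg_nonneg norm_ge_zero)
  finally have sd: "s * norm h < d" .
  define z where "z = (1 - s) *\<^sub>R x + s *\<^sub>R y"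
  have zx: "z - x = s *\<^sub>R h" by (simp add: z_def h_def algebra_simps)
  have zX: "z \<in> X" 
    unfolding z_def using conv x y s by (intro convexD) (auto simp: convex_on_def)
  have "norm (z - x) = s * norm h" using s zx by simp
  with d(2)[OF zX] sd have "\<bar>f z - f x - D (z - x)\<bar> \<le> e' * (s * norm h)" by simp
  moreover have "D (z - x) = s * D h"
    unfolding zx using has_derivative_bounded_linear[OF der] by (simp add: linear_simps(5))
  moreover have "f z \<le> (1 - s) * f x + s * f y"
    unfolding z_def using conv x y s by (intro convex_onD) auto
  ultimately have "s * (f y - f x - D h + e' * norm h) \<ge> 0" by (simp add: algebra_simps)
  then have "f y - f x - D h + e' * norm h \<ge> 0" using s by (simp add: zero_le_mult_iff)
  moreover have "e' * norm h \<le> e" using e hp by (simp add: e'_def field_simps)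
  ultimately show "f x + D (y - x) \<le> f y + e" unfolding h_def by linarith
qed

lemma convex_on_sum_family:
  assumes "convex X" and "\<And>i. convex_on X (h i)"
  shows "convex_on X (\<lambda>x. \<Sum>i\<in>I. h i x)"
proof -
  have "convex_on X (\<lambda>x. 0 :: real)" using assms(1) by (simp add: convex_on_def)
  then show ?thesis
    by (induction I rule: infinite_finite_induct) (auto intro!: convex_on_add assms(2))
qed

text \<open>Minimality of \<open>p\<close> is tested against points \<open>w\<close> on the segment
  from \<open>p\<close> to \<open>y\<close>. Expanding the square along the segment leaves a term of
  order \<open>s\<close> and a correction of order \<open>s^2\<close>; divide by \<open>s\<close>
  and let \<open>s\<close> tend to 0.\<close>

lemma prox_three_point:
  fixes h :: "'a::real_inner \<Rightarrow> real"
  assumes conv: "convex_on X h" and p: "p \<in> X" and y: "y \<in> X"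
    and min: "\<And>w. w \<in> X \<Longrightarrow> h p + \<alpha> * (norm (p - z))\<^sup>2 \<le> h w + \<alpha> * (norm (w - z))\<^sup>2"
  shows "h p + \<alpha> * (norm (p - z))\<^sup>2 \<le> h y + \<alpha> * (norm (y - z))\<^sup>2 - \<alpha> * (norm (y - p))\<^sup>2"
proof -
  \<comment> \<open>The claim is \<open>A \<ge> 0\<close>, and \<open>s * (A + s * B)\<close> bounds
    the increase of the objective from \<open>p\<close> to \<open>w\<close> from above.\<close>
  define A where "A = h y - h p + \<alpha> * ((norm (y - z))\<^sup>2 - (norm (p - z))\<^sup>2 - (norm (y - p))\<^sup>2)"
  define B where "B = \<alpha> * (norm (y - p))\<^sup>2"
  have ge: "A + s * B \<ge> 0" if s: "0 < s" "s < 1" for s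
  proof -
    define w where "w = (1 - s) *\<^sub>R p + s *\<^sub>R y"
    have wX: "w \<in> X"
      unfolding w_def using conv p y s by (intro convexD) (auto simp: convex_on_def)
    have hw: "h w \<le> (1 - s) * h p + s * h y"
      unfolding w_def using conv p y s by (intro convex_onD) auto
    have "w - z = (p - z) + s *\<^sub>R (y - p)" by (simp add: w_def algebra_simps)
    moreover have "y - z = (p - z) + (y - p)" by simp
    ultimately have "(norm (w - z))\<^sup>2
        = (1 - s) * (norm (p - z))\<^sup>2 + s * (norm (y - z))\<^sup>2 - s * (1 - s) * (norm (y - p))\<^sup>2"
      by (simp only: power2_norm_eq_inner inner_add_left inner_add_right inner_scaleR_left
          inner_scaleR_right) (simp add: algebra_simps inner_commute power2_eq_square)
    then have "\<alpha> * (norm (w - z))\<^sup>2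
        = \<alpha> * ((1 - s) * (norm (p - z))\<^sup>2 + s * (norm (y - z))\<^sup>2 - s * (1 - s) * (norm (y - p))\<^sup>2)"
      by simp
    with min[OF wX] hw have "s * (A + s * B) \<ge> 0"
      unfolding A_def B_def by (simp add: algebra_simps)
    then show ?thesis using s by (simp add: zero_le_mult_iff)
  qed
  have "((\<lambda>s. A + s * B) \<longlongrightarrow> A + 0 * B) (at_right 0)"
    by (intro tendsto_intros)
  moreover have "eventually (\<lambda>s. A + s * B \<ge> 0) (at_right 0)"
    using eventually_at_right_real[OF zero_less_one] by eventually_elim (use ge in auto)
  ultimately have "A \<ge> 0"
    by (intro tendsto_lowerbound[of "\<lambda>s. A + s * B" "A" "at_right 0"]) auto
  then show ?thesis by (simp add: A_def algebra_simps)
qed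

section \<open>Elementary inequalities for drift and telescoping\<close>

text \<open>The right side equals \<open>(l + a)^2 + a^2\<close>, and the left side is one of these
  two squares.\<close>

lemma max_drift_le:
  fixes l a :: real
  assumes "l \<ge> 0"
  shows "(max (l + a) (- a))\<^sup>2 \<le> l\<^sup>2 + 2 * (l * a) + 2 * a\<^sup>2"
proof (cases "l + a \<ge> - a")
  case True
  then have "max (l + a) (- a) = l + a" by simp
  then show ?thesis using zero_le_power2[of a] by (simp add: power2_sum mult.assoc)
next
  case False
  then have "max (l + a) (- a) = - a" by simp
  moreover have "l\<^sup>2 + 2 * (l * a) + 2 * a\<^sup>2 = (l + a)\<^sup>2 + a\<^sup>2" by (simp add: power2_sum)
  ultimately show ?thesis by simp
qed

text \<open>Telescoping: \<open>1 / b \<le> 2 * b - 2 * a\<close> for consecutive roots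
  \<open>a\<close> and \<open>b\<close>, which is \<open>(a - b)^2 \<ge> 0\<close> rewritten with
  \<open>b^2 = a^2 + 1\<close>.\<close>

lemma sum_inverse_sqrt_le: "(\<Sum>t=1..n. 1 / sqrt (real t)) \<le> 2 * sqrt (real n)"
proof (induction n)
  case (Suc n)
  define a b where "a = sqrt (real n)" and "b = sqrt (real (Suc n))"
  have b: "b > 0" "a \<ge> 0" "b\<^sup>2 = a\<^sup>2 + 1" by (auto simp: a_def b_def)
  have "1 + 2 * a * b \<le> 2 * b\<^sup>2" using b sum_squares_ge_zero[of "a - b" 0]
    by (simp add: power2_eq_square algebra_simps)
  then have "1 / b \<le> 2 * b - 2 * a" using b by (simp add: field_simps power2_eq_square)
  then show ?case using Suc by (simp add: a_def b_def)
qed simp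

text \<open>Turns an increment divided by the root of the running total into a telescoping
  difference. With \<open>a\<close> and \<open>b\<close> the two roots,
  \<open>d = (b - a) * (b + a)\<close>, and \<open>d \<le> R \<le> s\<close> forces
  \<open>b \<le> 2 * a\<close>, whence the factor 3.\<close>

lemma div_sqrt_le_sqrt_diff:
  fixes s d R :: real
  assumes "s \<ge> R" "R > 0" "0 \<le> d" "d \<le> R"
  shows "d / sqrt s \<le> 3 * (sqrt (s + d) - sqrt s)"
proof -
  define a b where "a = sqrt s" and "b = sqrt (s + d)"
  have ab: "a > 0" "b \<ge> 0" "a\<^sup>2 = s" "b\<^sup>2 = s + d" using assms by (auto simp: a_def b_def)
  have "b\<^sup>2 \<le> (2 * a)\<^sup>2" using ab assms by (simp add: power_mult_distrib)
  then have b2: "b \<le> 2 * a" using ab by (auto intro: power2_le_imp_le)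
  have ba: "a \<le> b" using assms by (simp add: a_def b_def)
  have "d = (b - a) * (b + a)" using ab by (simp add: algebra_simps power2_eq_square)
  also have "\<dots> \<le> (b - a) * (3 * a)" using b2 ba by (intro mult_left_mono) auto
  finally show ?thesis unfolding a_def[symmetric] b_def[symmetric] using ab by (simp add: field_simps)
qed

lemma norm_square_half_sum_le:
  fixes a b :: "'a::real_inner"
  shows "(norm (a + b))\<^sup>2 / 2 \<le> (norm a)\<^sup>2 + (norm b)\<^sup>2"
proof -
  have "(norm (a - b))\<^sup>2 \<ge> 0" by simp
  then show ?thesis
    by (simp add: power2_norm_eq_inner inner_add_left inner_add_right inner_diff_left
        inner_diff_right inner_commute field_simps)
qed

text \<open>
  \<^const>\<open>vqb_run\<close> determines the queue before round \<open>T\<close> only; its value at \<open>T\<close> is needed to telescope.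
\<close>

primrec queue ::
    "(nat \<Rightarrow> real) \<Rightarrow> (nat \<Rightarrow> 'a \<Rightarrow> real ^ 'k) \<Rightarrow> (nat \<Rightarrow> 'a) \<Rightarrow> nat \<Rightarrow> real ^ 'k" where
  "queue \<gamma> g x 0 = 0"
| "queue \<gamma> g x (Suc t) = (\<chi> k. max (queue \<gamma> g x t $ k + \<gamma> t * g t (x (Suc t)) $ k)
                                   (- (\<gamma> t * g t (x (Suc t)) $ k)))"

section \<open>Constants and the common setting of both cases\<close>

text \<open>Its square is the coefficient of \<open>T\<close> in the bound on the squared norm of
  the final queue. The term \<open>4 * F\<close> is due to loss differences of at least
  \<open>- 2 * F\<close>, and 9 = 8 + 1 collects the changes of the scaled constraints and a
  boundary term.\<close>

definition queue_const :: "real \<Rightarrow> real \<Rightarrow> real \<Rightarrow> real \<Rightarrow> real" where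
  "queue_const R F G c =
     sqrt (4 * F + 2 * ((7 * R + G\<^sup>2 / 2) * sqrt (2 * R)) + 9 * (c * F)\<^sup>2)"

text \<open>One constant serves all four estimates, with \<open>c\<close> in the role of
  \<open>\<gamma> 0\<close>: it adds up the nonnegative coefficients that occur in any of them.
  Division by \<open>sqrt R\<close> trades a bare constant for a multiple of the root of
  \<open>T * max R Vx\<close>.\<close>

definition bound_const :: "real \<Rightarrow> real \<Rightarrow> real \<Rightarrow> real \<Rightarrow> real" where
  "bound_const R F G c =
     (2 * F + 9 * (c * F)\<^sup>2) / sqrt R + 2 * (7 * R + G\<^sup>2 / 2) + 2 * c\<^sup>2 * F + F + 1 + queue_const R F G c / c"

text \<open>Abstracts from the two schedules: \<gamma> is positive and nonincreasing, and
  \<open>gamma_le\<close> makes the squared Lipschitz constant of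
  \<open>\<gamma> t *\<^sub>R g t\<close> at most half of \<open>1 / sqrt R\<close>, which is a
  lower bound for \<alpha>.\<close>

locale vqb_instance =
  fixes R F G :: real and X :: "'a::real_inner set" and f df
    and g :: "nat \<Rightarrow> 'a \<Rightarrow> real ^ 'k" and dg xstar \<alpha> \<gamma> lam x T
  assumes R_pos: "R > 0" and T_ge: "T \<ge> 1"
    and problem: "online_problem X g T"
    and standing: "standing_assumptions R F G X f df g dg T"
    and minimizers: "slot_minimizers X f g T xstar"
    and xstar_0: "xstar 0 = xstar 1"
    and run: "vqb_run X df g \<alpha> \<gamma> T lam x"
    and alpha: "\<And>t. t \<in> {1..T} \<Longrightarrow>
      \<alpha> t = sqrt (real T / (R + (\<Sum>i=1..t. norm (xstar i - xstar (i - 1)))))"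
    and gamma_pos: "\<And>t. \<gamma> t > 0"
    and gamma_decreasing: "\<And>t. \<gamma> (Suc t) \<le> \<gamma> t"
    and gamma_le: "\<And>t. 2 * (real CARD('k) * G)\<^sup>2 * (\<gamma> t)\<^sup>2 \<le> 1 / sqrt R"
begin

abbreviation "Q \<equiv> queue \<gamma> g x"

definition "u t = \<gamma> t *\<^sub>R g t (x (Suc t))"

definition "S t = (\<Sum>i=1..t. norm (xstar i - xstar (i - 1)))"

text \<open>The scale of the regret: the sum of the \<open>1 / \<alpha> t\<close> and the cost of
  tracking the moving minimizers are both at most a constant times this.\<close>

definition "W = sqrt (real T * (R + path_variation T xstar))"

text \<open>Both terms are evaluated at the same point \<open>x t\<close>, which separates the
  change of the scaled constraint from the movement of the iterate.\<close>

definition "scaled_change t = (norm (\<gamma> t *\<^sub>R g t (x t) - \<gamma> (t - 1) *\<^sub>R g (t - 1) (x t)))\<^sup>2"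

section \<open>Consequences of the standing assumptions\<close>

lemma convex_X: "convex X" and X_nonempty: "X \<noteq> {}"
  using problem by (auto simp: online_problem_def)

lemma diameter: "y \<in> X \<Longrightarrow> z \<in> X \<Longrightarrow> norm (y - z) \<le> R"
  using standing by (auto simp: standing_assumptions_def)

lemma convex_f: "t \<in> {1..T} \<Longrightarrow> convex_on X (f t)"
  and convex_g: "t \<in> {1..T} \<Longrightarrow> convex_on X (\<lambda>y. g t y $ k)"
  and f_bound: "t \<in> {1..T} \<Longrightarrow> y \<in> X \<Longrightarrow> \<bar>f t y\<bar> \<le> F"
  and g_bound: "t \<in> {1..T} \<Longrightarrow> y \<in> X \<Longrightarrow> norm (g t y) \<le> F"
  and f_deriv: "t \<in> {1..T} \<Longrightarrow> y \<in> X \<Longrightarrow> (f t has_derivative (\<lambda>h. df t y \<bullet> h)) (at y within X)"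
  and df_bound: "t \<in> {1..T} \<Longrightarrow> y \<in> X \<Longrightarrow> norm (df t y) \<le> G"
  and g_deriv: "t \<in> {1..T} \<Longrightarrow> y \<in> X \<Longrightarrow>
    ((\<lambda>y. g t y $ k) has_derivative (\<lambda>h. dg t k y \<bullet> h)) (at y within X)"
  and dg_bound: "t \<in> {1..T} \<Longrightarrow> y \<in> X \<Longrightarrow> norm (dg t k y) \<le> G"
  using standing by (auto simp: standing_assumptions_def)

lemma g_0: "g 0 y = 0"
  using run by (auto simp: vqb_run_def)

lemma F_nonneg: "F \<ge> 0"
proof -
  obtain y where "y \<in> X" using X_nonempty by blast
  then show ?thesis using f_bound[of 1 y] T_ge by auto
qed

lemma g_bound': "t \<le> T \<Longrightarrow> y \<in> X \<Longrightarrow> norm (g t y) \<le> F"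
  using g_bound[of t y] g_0[of y] F_nonneg by (cases "t = 0") auto

text \<open>The tangent inequality at either point makes each component \<open>G\<close>-Lipschitz;
  the Euclidean norm is at most the sum of the absolute components, whence the factor
  \<open>CARD('k)\<close>.\<close>

lemma g_lipschitz:
  assumes t: "t \<in> {1..T}" and y: "y \<in> X" and z: "z \<in> X"
  shows "norm (g t y - g t z) \<le> real CARD('k) * G * norm (y - z)"
proof -
  have 1: "g t v $ k - g t w $ k \<le> G * norm (v - w)" if v: "v \<in> X" and w: "w \<in> X" for v w k
  proof -
    have "g t v $ k + dg t k v \<bullet> (w - v) \<le> g t w $ k"
      using convex_on_above_derivative[OF convex_g[OF t] g_deriv[OF t v] v w] .
    moreover have "- (dg t k v \<bullet> (w - v)) \<le> norm (dg t k v) * norm (w - v)"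
      using norm_cauchy_schwarz[of "- dg t k v" "w - v"] by simp
    moreover have "norm (dg t k v) * norm (w - v) \<le> G * norm (w - v)"
      using dg_bound[OF t v] by (intro mult_right_mono) auto
    ultimately show ?thesis by (simp add: norm_minus_commute)
  qed
  have "norm (g t y - g t z) \<le> (\<Sum>k\<in>UNIV. \<bar>(g t y - g t z) $ k\<bar>)" by (rule norm_le_l1_cart)
  also have "\<dots> \<le> (\<Sum>k\<in>(UNIV :: 'k set). G * norm (y - z))"
  proof (rule sum_mono)
    fix k show "\<bar>(g t y - g t z) $ k\<bar> \<le> G * norm (y - z)"
      using 1[OF y z, of k] 1[OF z y, of k] by (simp add: norm_minus_commute abs_le_iff)
  qed
  finally show ?thesis by simp
qed

lemma step_minimizer:
  "t \<in> {1..<T} \<Longrightarrow> is_arg_min (vqb_objective (df t) g \<alpha> \<gamma> (lam t) (x t) t) (\<lambda>y. y \<in> X) (x (Suc t))"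
  using run unfolding vqb_run_def Suc_eq_plus1 by blast

lemma x_in_X:
  assumes t: "t \<in> {1..T}"
  shows "x t \<in> X"
proof (cases "t = 1")
  case True
  then show ?thesis using run by (simp add: vqb_run_def)
next
  case False
  then have "t - 1 \<in> {1..<T}" "Suc (t - 1) = t" using t by auto
  then show ?thesis using step_minimizer[of "t - 1"] by (simp add: is_arg_min_def)
qed

lemma xstar_in_X: "t \<in> {1..T} \<Longrightarrow> xstar t \<in> X"
  and g_xstar_le: "t \<in> {1..T} \<Longrightarrow> g t (xstar t) \<le> 0"
  using minimizers by (auto simp: slot_minimizers_def is_arg_min_def)

section \<open>The virtual queue\<close>

lemma lam_eq_queue: "t < T \<Longrightarrow> lam t = Q t"
proof (induction t)
  case 0
  then show ?case using run by (simp add: vqb_run_def)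
next
  case (Suc t)
  have "lam (Suc t) = (\<chi> k. max (lam t $ k + \<gamma> t * g t (x (Suc t)) $ k)
                          (- (\<gamma> t * g t (x (Suc t)) $ k)))"
    using run Suc.prems by (auto simp: vqb_run_def)
  then show ?case using Suc by simp
qed

lemma queue_nonneg: "Q t $ k \<ge> 0"
  by (induction t) (auto simp: max_def)

lemma u_0: "u 0 = 0"
  by (simp add: u_def g_0)

lemma queue_1: "Q (Suc 0) = 0"
  by (simp add: g_0 vec_eq_iff)

text \<open>The second argument of the maximum is \<open>- u t\<close>. Hence the constraint weights
  in the objective are nonnegative, which gives convexity and a nonpositive contribution at feasible
  points.\<close>

lemma queue_plus_u_nonneg: "(Q (Suc t) + u t) $ k \<ge> 0"
  by (simp add: u_def max_def)

lemma queue_drift: "(norm (Q (Suc t)))\<^sup>2 \<le> (norm (Q t))\<^sup>2 + 2 * (Q t \<bullet> u t) + 2 * (norm (u t))\<^sup>2"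
proof -
  have "(\<Sum>k\<in>UNIV. (Q (Suc t) $ k)\<^sup>2)
      \<le> (\<Sum>k\<in>UNIV. (Q t $ k)\<^sup>2 + 2 * (Q t $ k * u t $ k) + 2 * (u t $ k)\<^sup>2)"
    by (rule sum_mono) (use max_drift_le[OF queue_nonneg] in \<open>simp add: u_def\<close>)
  then show ?thesis
    unfolding power2_norm_eq_inner inner_vec_def inner_real_def
    by (simp add: power2_eq_square sum.distrib sum_distrib_left del: queue.simps)
qed

section \<open>Path length and step sizes\<close>

lemma xstar_step_le:
  assumes t: "t \<in> {1..T}"
  shows "norm (xstar t - xstar (t - 1)) \<le> R"
proof (cases "t = 1")
  case True
  then show ?thesis using xstar_0 R_pos by simp
next
  case False
  then have "t - 1 \<in> {1..T}" using t by auto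
  then show ?thesis using diameter xstar_in_X t by blast
qed

lemma S_Suc: "S (Suc t) = S t + norm (xstar (Suc t) - xstar t)"
  by (simp add: S_def)

lemma S_nonneg: "S t \<ge> 0"
  by (simp add: S_def sum_nonneg)

lemma S_mono: "s \<le> t \<Longrightarrow> S s \<le> S t"
  by (rule lift_Suc_mono_le[of S]) (auto simp: S_Suc)

lemma S_1: "S (Suc 0) = 0"
  using xstar_0 by (simp add: S_def)

lemma S_T: "S T = path_variation T xstar"
proof -
  have "S T = norm (xstar 1 - xstar 0) + path_variation T xstar"
    unfolding S_def path_variation_def
    using sum.atLeast_Suc_atMost[OF T_ge, of "\<lambda>i. norm (xstar i - xstar (i - 1))"]
    by (simp add: numeral_2_eq_2)
  then show ?thesis using xstar_0 by simp
qed

text \<open>The first of the \<open>t\<close> increments vanishes because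
  \<open>xstar 0 = xstar 1\<close>, and each of the others is at most \<open>R\<close>.\<close>

lemma S_bound: "t \<in> {1..T} \<Longrightarrow> R + S t \<le> R * real t"
proof (induction t)
  case (Suc t)
  show ?case
  proof (cases "t = 0")
    case True
    then show ?thesis using S_1 by simp
  next
    case False
    then show ?thesis using Suc xstar_step_le[of "Suc t"] by (simp add: S_Suc algebra_simps)
  qed
qed simp

lemma alpha_S: "t \<in> {1..T} \<Longrightarrow> \<alpha> t = sqrt (real T) / sqrt (R + S t)"
  using alpha[of t] by (simp add: S_def real_sqrt_divide)

lemma sqrt_RS_pos: "sqrt (R + S t) > 0"
  using R_pos S_nonneg[of t] by simp

text \<open>Follows from \<open>R + S t \<le> R * T\<close>. It lets the proximal term dominate the
  squared movement of the scaled constraints.\<close>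

lemma alpha_ge:
  assumes t: "t \<in> {1..T}"
  shows "1 / sqrt R \<le> \<alpha> t"
proof -
  have "R * real t \<le> R * real T" using t R_pos by (intro mult_left_mono) auto
  then have "R + S t \<le> R * real T" using S_bound[OF t] by linarith
  then have "sqrt (R + S t) \<le> sqrt R * sqrt (real T)" by (simp flip: real_sqrt_mult)
  then show ?thesis unfolding alpha_S[OF t] using R_pos sqrt_RS_pos[of t] by (simp add: field_simps)
qed

lemma alpha_pos: "t \<in> {1..T} \<Longrightarrow> \<alpha> t > 0"
  using alpha_ge[of t] R_pos by (smt (verit) divide_pos_pos real_sqrt_gt_zero)

lemma alpha_decreasing:
  assumes "t \<in> {1..<T}"
  shows "\<alpha> (Suc t) \<le> \<alpha> t"
proof -
  have "sqrt (R + S t) \<le> sqrt (R + S (Suc t))" using S_mono[of t "Suc t"] by simp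
  then show ?thesis
    using assms alpha_S[of t] alpha_S[of "Suc t"] sqrt_RS_pos[of t] sqrt_RS_pos[of "Suc t"]
    by (auto intro!: divide_left_mono)
qed

text \<open>The path length up to \<open>t\<close> is at most the total one; fewer than
  \<open>T\<close> such terms then add up to at most \<open>W\<close>.\<close>

lemma inverse_alpha_le:
  assumes t: "t \<in> {1..T}"
  shows "1 / \<alpha> t \<le> W / real T"
proof -
  have "1 / \<alpha> t = sqrt (R + S t) / sqrt (real T)" using alpha_S[OF t] by simp
  also have "\<dots> \<le> sqrt (R + S T) / sqrt (real T)"
    using S_mono[of t T] t by (auto intro!: divide_right_mono)
  also have "\<dots> = W / (sqrt (real T) * sqrt (real T))"
    using T_ge by (simp add: W_def S_T real_sqrt_mult del: real_sqrt_mult_self)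
  also have "\<dots> = W / real T" by simp
  finally show ?thesis .
qed

lemma gamma_mono: "s \<le> t \<Longrightarrow> \<gamma> t \<le> \<gamma> s"
  by (rule lift_Suc_antimono_le[of \<gamma>]) (auto intro: gamma_decreasing)

section \<open>The inequality for one round\<close>

text \<open>The proximal term \<open>\<alpha> t * (norm d)^2\<close> is spent in halves: one absorbs
  the gradient term by Young's inequality, the other the part of \<open>u t - u (t - 1)\<close>
  caused by the movement \<open>d\<close>. The drift cancels
  \<open>Q t \<bullet> u t\<close>.\<close>

lemma loss_plus_drift_le:
  assumes t: "t \<in> {1..<T}"
  shows "f t (x t) - f t (xstar t) + ((norm (Q (Suc t)))\<^sup>2 / 2 - (norm (Q t))\<^sup>2 / 2)
    \<le> G\<^sup>2 / 2 * (1 / \<alpha> t) + scaled_change t + ((norm (u t))\<^sup>2 / 2 - (norm (u (t - 1)))\<^sup>2 / 2)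
      + \<alpha> t * ((norm (xstar t - x t))\<^sup>2 - (norm (xstar t - x (Suc t)))\<^sup>2)"
proof -
  have t1: "t \<in> {1..T}" "Suc t \<in> {1..T}" "t < T" "Suc (t - 1) = t" using t by auto
  note xt = x_in_X[OF t1(1)] and xt' = x_in_X[OF t1(2)] and xs = xstar_in_X[OF t1(1)]
  \<comment> \<open>The constraint weight in the objective of round \<open>t\<close>:
    \<open>u (t - 1)\<close> is evaluated at \<open>x t\<close>, so it is the term added to
    \<lambda> there.\<close>
  define q where "q = Q t + u (t - 1)"
  define d where "d = x (Suc t) - x t"
  define h where "h y = df t (x t) \<bullet> (y - x t) + q \<bullet> (\<gamma> t *\<^sub>R g t y)" for y
  have q: "q $ k \<ge> 0" for k using queue_plus_u_nonneg[of "t - 1" k] t1 by (simp add: q_def)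
  have obj: "vqb_objective (df t) g \<alpha> \<gamma> (lam t) (x t) t y = h y + \<alpha> t * (norm (y - x t))\<^sup>2" for y
    using lam_eq_queue[OF t1(3)] t1(4) by (simp add: vqb_objective_def h_def q_def u_def)
  have "convex_on X (\<lambda>y. df t (x t) \<bullet> (y - x t))"
    by (rule convex_onI[OF _ convex_X]) (simp add: inner_diff_right inner_add_right algebra_simps)
  moreover have "convex_on X (\<lambda>y. q \<bullet> (\<gamma> t *\<^sub>R g t y))"
  proof -
    have "convex_on X (\<lambda>y. (q $ k * \<gamma> t) * g t y $ k)" for k
      using q gamma_pos[of t] by (intro convex_on_cmul convex_g t1) (simp add: less_imp_le)
    then have "convex_on X (\<lambda>y. \<Sum>k\<in>UNIV. (q $ k * \<gamma> t) * g t y $ k)"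
      by (rule convex_on_sum_family[OF convex_X])
    then show ?thesis by (simp add: inner_vec_def mult.assoc)
  qed
  ultimately have "convex_on X h" unfolding h_def by (rule convex_on_add)
  then have "h (x (Suc t)) + \<alpha> t * (norm d)\<^sup>2
      \<le> h (xstar t) + \<alpha> t * (norm (xstar t - x t))\<^sup>2 - \<alpha> t * (norm (xstar t - x (Suc t)))\<^sup>2"
    unfolding d_def
    by (rule prox_three_point[OF _ xt' xs])
       (use step_minimizer[OF t] in \<open>auto simp: is_arg_min_linorder obj\<close>)
  moreover have "h (xstar t) \<le> f t (xstar t) - f t (x t)"
  proof -
    have "q \<bullet> (\<gamma> t *\<^sub>R g t (xstar t)) \<le> 0"
      unfolding inner_vec_def using q gamma_pos[of t] g_xstar_le[OF t1(1)]
      by (intro sum_nonpos) (auto simp: less_eq_vec_def mult_le_0_iff less_imp_le)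
    then show ?thesis unfolding h_def
      using convex_on_above_derivative[OF convex_f[OF t1(1)] f_deriv[OF t1(1) xt] xt xs] by simp
  qed
  moreover have "h (x (Suc t)) = df t (x t) \<bullet> d + Q t \<bullet> u t + u (t - 1) \<bullet> u t"
    by (simp add: h_def q_def d_def u_def inner_add_left distrib_left)
  moreover have "(norm (u t - u (t - 1)))\<^sup>2 / 2 \<le> \<alpha> t / 2 * (norm d)\<^sup>2 + scaled_change t"
  proof -
    \<comment> \<open>Split at \<open>\<gamma> t *\<^sub>R g t (x t)\<close>: \<open>a\<close> stems
      from the movement of the iterate, \<open>b\<close> from the change of the scaled
      constraint.\<close>
    define a where "a = \<gamma> t *\<^sub>R (g t (x (Suc t)) - g t (x t))"
    define b where "b = \<gamma> t *\<^sub>R g t (x t) - \<gamma> (t - 1) *\<^sub>R g (t - 1) (x t)"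
    have "u t - u (t - 1) = a + b" using t1(4) by (simp add: u_def a_def b_def algebra_simps)
    then have "(norm (u t - u (t - 1)))\<^sup>2 / 2 \<le> (norm a)\<^sup>2 + (norm b)\<^sup>2"
      using norm_square_half_sum_le[of a b] by simp
    moreover have "(norm b)\<^sup>2 = scaled_change t" by (simp add: b_def scaled_change_def)
    moreover have "(norm a)\<^sup>2 \<le> \<alpha> t / 2 * (norm d)\<^sup>2"
    proof -
      have "norm a \<le> \<gamma> t * (real CARD('k) * G * norm d)"
        using mult_left_mono[OF g_lipschitz[OF t1(1) xt' xt], of "\<gamma> t"] gamma_pos[of t]
        by (simp add: a_def d_def)
      then have "(norm a)\<^sup>2 \<le> (\<gamma> t * (real CARD('k) * G * norm d))\<^sup>2" by (intro power_mono) auto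
      also have "\<dots> = (real CARD('k) * G)\<^sup>2 * (\<gamma> t)\<^sup>2 * (norm d)\<^sup>2"
        by (simp add: power_mult_distrib)
      \<comment> \<open>The smallness of \<gamma> and the lower bound on \<alpha> meet at
        \<open>1 / sqrt R\<close>.\<close>
      also have "\<dots> \<le> \<alpha> t / 2 * (norm d)\<^sup>2"
        using gamma_le[of t] alpha_ge[OF t1(1)] by (intro mult_right_mono) auto
      finally show ?thesis .
    qed
    ultimately show ?thesis by linarith
  qed
  \<comment> \<open>The cross term, present because the objective adds the last scaled constraint to
    the queue, is traded for telescoping squares and a squared difference.\<close>
  moreover have "(norm (u t - u (t - 1)))\<^sup>2 = (norm (u t))\<^sup>2 - 2 * (u (t - 1) \<bullet> u t) + (norm (u (t - 1)))\<^sup>2"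
    by (simp add: power2_norm_eq_inner inner_diff_left inner_diff_right inner_commute)
  moreover have "- (df t (x t) \<bullet> d) \<le> G\<^sup>2 / 2 * (1 / \<alpha> t) + \<alpha> t / 2 * (norm d)\<^sup>2"
  proof -
    have al: "\<alpha> t > 0" by (rule alpha_pos[OF t1(1)])
    have "- (df t (x t) \<bullet> d) \<le> norm (df t (x t)) * norm d"
      using norm_cauchy_schwarz[of "- df t (x t)" d] by simp
    also have "\<dots> \<le> G * norm d" using df_bound[OF t1(1) xt] by (intro mult_right_mono) auto
    also have "\<dots> \<le> G\<^sup>2 / 2 * (1 / \<alpha> t) + \<alpha> t / 2 * (norm d)\<^sup>2"
    proof -
      have "(G - \<alpha> t * norm d)\<^sup>2 \<ge> 0" by simp
      then show ?thesis using al by (simp add: field_simps power2_eq_square)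
    qed
    finally show ?thesis .
  qed
  moreover have "\<alpha> t / 2 * (norm d)\<^sup>2 + \<alpha> t / 2 * (norm d)\<^sup>2 = \<alpha> t * (norm d)\<^sup>2" by simp
  ultimately show ?thesis
    using queue_drift[of t] unfolding right_diff_distrib diff_divide_distrib add_divide_distrib
    by argo
qed

text \<open>Replacing \<open>xstar t\<close> by its successor changes the squared distance by at
  most \<open>2 * R * e\<close>, where \<open>e\<close> is the path increment. Weighted by
  \<open>\<alpha> t\<close>, this is an increment over the root of the running total, so it
  telescopes with the factor 2 * 3 = 6. The new weight \<open>\<alpha> (Suc t)\<close> is allowed
  because \<alpha> decreases.\<close>

lemma tracking_le:
  assumes t: "t \<in> {1..<T}"
  shows "\<alpha> t * ((norm (xstar t - x t))\<^sup>2 - (norm (xstar t - x (Suc t)))\<^sup>2)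
    \<le> (\<alpha> t * (norm (xstar t - x t))\<^sup>2 - \<alpha> (Suc t) * (norm (xstar (Suc t) - x (Suc t)))\<^sup>2)
      + 6 * R * sqrt (real T) * (sqrt (R + S (Suc t)) - sqrt (R + S t))"
proof -
  have t1: "t \<in> {1..T}" "Suc t \<in> {1..T}" using t by auto
  define a b e where "a = norm (xstar (Suc t) - x (Suc t))" and "b = norm (xstar t - x (Suc t))"
    and "e = norm (xstar (Suc t) - xstar t)"
  have ab: "0 \<le> a" "0 \<le> b" "a \<le> R" "b \<le> R" "0 \<le> e" "e \<le> R"
    using diameter xstar_in_X x_in_X t1 by (auto simp: a_def b_def e_def)
  have "a \<le> b + e" unfolding a_def b_def e_def
    using norm_triangle_ineq[of "xstar t - x (Suc t)" "xstar (Suc t) - xstar t"] by simp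
  have "a\<^sup>2 - b\<^sup>2 \<le> 2 * R * e"
  proof (cases "a \<le> b")
    case True
    then have "a\<^sup>2 \<le> b\<^sup>2" using ab by (simp add: power_mono)
    moreover have "0 \<le> 2 * R * e" using ab R_pos by simp
    ultimately show ?thesis by linarith
  next
    case False
    have "a\<^sup>2 - b\<^sup>2 = (a + b) * (a - b)" by (simp add: algebra_simps power2_eq_square)
    also have "\<dots> \<le> (2 * R) * e" using False ab \<open>a \<le> b + e\<close> by (intro mult_mono) auto
    finally show ?thesis .
  qed
  then have "\<alpha> t * (a\<^sup>2 - b\<^sup>2) \<le> \<alpha> t * (2 * R * e)"
    using alpha_pos[OF t1(1)] by (intro mult_left_mono) auto
  also have "\<dots> = 2 * R * sqrt (real T) * (e / sqrt (R + S t))"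
    using alpha_S[OF t1(1)] by simp
  also have "\<dots> \<le> 2 * R * sqrt (real T) * (3 * (sqrt (R + S t + e) - sqrt (R + S t)))"
    using div_sqrt_le_sqrt_diff[of R "R + S t" e] ab R_pos S_nonneg[of t]
    by (intro mult_left_mono) auto
  also have "R + S t + e = R + S (Suc t)" by (simp add: S_Suc e_def)
  finally have "\<alpha> t * (a\<^sup>2 - b\<^sup>2) \<le> 6 * R * sqrt (real T) * (sqrt (R + S (Suc t)) - sqrt (R + S t))"
    by (simp add: algebra_simps)
  moreover have "\<alpha> (Suc t) * a\<^sup>2 \<le> \<alpha> t * a\<^sup>2"
    using alpha_decreasing[OF t] by (intro mult_right_mono) auto
  ultimately show ?thesis unfolding a_def[symmetric] b_def[symmetric]
    by (simp add: algebra_simps)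
qed

section \<open>Summation over the rounds\<close>

lemma norm_u_le:
  assumes "t < T"
  shows "norm (u t) \<le> \<gamma> 0 * F"
proof -
  have "norm (g t (x (Suc t))) \<le> F" using g_bound'[of t "x (Suc t)"] x_in_X[of "Suc t"] assms by auto
  then have "\<gamma> t * norm (g t (x (Suc t))) \<le> \<gamma> 0 * F"
    using gamma_mono[of 0 t] gamma_pos[of 0] gamma_pos[of t] by (intro mult_mono) auto
  then show ?thesis using gamma_pos[of t] by (simp add: u_def)
qed

text \<open>The queue telescopes from \<open>Q 1 = 0\<close> and the squares of \<open>u\<close>
  from \<open>u 0 = 0\<close>. In the coefficient, \<open>7 * R\<close> is \<open>R\<close> from the
  initial distance to \<open>xstar 1\<close> plus \<open>6 * R\<close> from tracking, and
  \<open>G^2 / 2\<close> comes from the gradient terms.\<close>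

lemma sum_loss_plus_queue_le:
  "(\<Sum>t\<in>{1..<T}. f t (x t) - f t (xstar t)) + (norm (Q T))\<^sup>2 / 2
    \<le> (7 * R + G\<^sup>2 / 2) * W + (\<Sum>t\<in>{1..<T}. scaled_change t) + (\<gamma> 0 * F)\<^sup>2 / 2"
proof -
  define D where "D t = (norm (xstar t - x t))\<^sup>2" for t
  define b where "b t = G\<^sup>2 / 2 * (W / real T) + scaled_change t + ((norm (Q t))\<^sup>2 / 2 - (norm (Q (Suc t)))\<^sup>2 / 2)
        + ((norm (u t))\<^sup>2 / 2 - (norm (u (t - 1)))\<^sup>2 / 2) + (\<alpha> t * D t - \<alpha> (Suc t) * D (Suc t))
        + 6 * R * sqrt (real T) * (sqrt (R + S (Suc t)) - sqrt (R + S t))" for t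
  have b: "f t (x t) - f t (xstar t) \<le> b t" if t: "t \<in> {1..<T}" for t
  proof -
    have "G\<^sup>2 / 2 * (1 / \<alpha> t) \<le> G\<^sup>2 / 2 * (W / real T)"
      using inverse_alpha_le[of t] t by (intro mult_left_mono) auto
    then show ?thesis using loss_plus_drift_le[OF t] tracking_le[OF t] unfolding b_def D_def by linarith
  qed
  have tel: "(\<Sum>t\<in>{1..<T}. p (Suc t) - p t) = p T - p 1" for p :: "nat \<Rightarrow> real"
    using sum_Suc_diff'[OF T_ge] .
  have tel': "(\<Sum>t\<in>{1..<T}. p t - p (Suc t)) = p 1 - p T" for p :: "nat \<Rightarrow> real"
    using tel[of "\<lambda>t. - p t"] by simp
  have "(\<Sum>t\<in>{1..<T}. f t (x t) - f t (xstar t)) \<le> (\<Sum>t\<in>{1..<T}. b t)"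
    by (rule sum_mono) (rule b)
  also have "\<dots> = (\<Sum>t\<in>{1..<T}. G\<^sup>2 / 2 * (W / real T)) + (\<Sum>t\<in>{1..<T}. scaled_change t)
        + ((norm (Q 1))\<^sup>2 / 2 - (norm (Q T))\<^sup>2 / 2)
        + (\<Sum>t\<in>{1..<T}. (norm (u t))\<^sup>2 / 2 - (norm (u (t - 1)))\<^sup>2 / 2)
        + (\<alpha> 1 * D 1 - \<alpha> T * D T)
        + 6 * R * sqrt (real T) * (sqrt (R + S T) - sqrt (R + S 1))"
    unfolding b_def sum.distrib sum_distrib_left[symmetric] tel[of "\<lambda>t. sqrt (R + S t)"]
      tel'[of "\<lambda>t. (norm (Q t))\<^sup>2 / 2"] tel'[of "\<lambda>t. \<alpha> t * D t"] ..
  finally have "(\<Sum>t\<in>{1..<T}. f t (x t) - f t (xstar t))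
      \<le> (\<Sum>t\<in>{1..<T}. G\<^sup>2 / 2 * (W / real T)) + (\<Sum>t\<in>{1..<T}. scaled_change t)
        + ((norm (Q 1))\<^sup>2 / 2 - (norm (Q T))\<^sup>2 / 2)
        + (\<Sum>t\<in>{1..<T}. (norm (u t))\<^sup>2 / 2 - (norm (u (t - 1)))\<^sup>2 / 2)
        + (\<alpha> 1 * D 1 - \<alpha> T * D T)
        + 6 * R * sqrt (real T) * (sqrt (R + S T) - sqrt (R + S 1))" .
  moreover have "(\<Sum>t\<in>{1..<T}. G\<^sup>2 / 2 * (W / real T)) \<le> G\<^sup>2 / 2 * W"
  proof -
    have W: "W \<ge> 0" using S_nonneg[of T] S_T R_pos by (simp add: W_def)
    have "(\<Sum>t\<in>{1..<T}. G\<^sup>2 / 2 * (W / real T)) \<le> real T * (G\<^sup>2 / 2 * (W / real T))"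
      using W by (simp only: sum_constant card_atLeastLessThan, intro mult_right_mono) auto
    then show ?thesis using T_ge by simp
  qed
  moreover have "(\<Sum>t\<in>{1..<T}. (norm (u t))\<^sup>2 / 2 - (norm (u (t - 1)))\<^sup>2 / 2) \<le> (\<gamma> 0 * F)\<^sup>2 / 2"
  proof -
    have "(\<Sum>t\<in>{1..<T}. (norm (u t))\<^sup>2 / 2 - (norm (u (t - 1)))\<^sup>2 / 2) = (norm (u (T - 1)))\<^sup>2 / 2"
      using tel[of "\<lambda>t. (norm (u (t - 1)))\<^sup>2 / 2"] u_0 by simp
    also have "\<dots> \<le> (\<gamma> 0 * F)\<^sup>2 / 2"
      using norm_u_le[of "T - 1"] T_ge by (intro divide_right_mono power_mono) auto
    finally show ?thesis .
  qed
  \<comment> \<open>Since \<open>S 1 = 0\<close>, the first weight is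
    \<open>sqrt (T / R)\<close>.\<close>
  moreover have "\<alpha> 1 * D 1 \<le> R * W"
  proof -
    have "D 1 \<le> R\<^sup>2" unfolding D_def
      using diameter[OF xstar_in_X x_in_X, of 1 1] T_ge by (intro power_mono) auto
    then have "\<alpha> 1 * D 1 \<le> sqrt (real T) / sqrt R * R\<^sup>2"
      using alpha_S[of 1] S_1 T_ge R_pos by (auto intro!: divide_right_mono mult_left_mono)
    also have "\<dots> = R * (sqrt (real T) * sqrt R)"
      using R_pos real_div_sqrt[of R] by (simp add: power2_eq_square field_simps)
    also have "sqrt (real T) * sqrt R \<le> W"
      unfolding W_def real_sqrt_mult[symmetric] using S_nonneg[of T] S_T
      by (intro real_sqrt_le_mono mult_left_mono) auto
    finally show ?thesis using R_pos by simp
  qed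
  moreover have "\<alpha> T * D T \<ge> 0" using alpha_pos[of T] T_ge by (simp add: D_def less_imp_le)
  moreover have "6 * R * sqrt (real T) * (sqrt (R + S T) - sqrt (R + S 1)) \<le> 6 * R * W"
  proof -
    have "6 * R * sqrt (real T) * (sqrt (R + S T) - sqrt (R + S 1)) \<le> 6 * R * sqrt (real T) * sqrt (R + S T)"
      using R_pos sqrt_RS_pos[of 1] by (intro mult_left_mono) auto
    then show ?thesis by (simp add: W_def S_T real_sqrt_mult)
  qed
  moreover have "(norm (Q 1))\<^sup>2 / 2 = 0" using queue_1 by (simp del: queue.simps)
  moreover have "(7 * R + G\<^sup>2 / 2) * W = 6 * R * W + R * W + G\<^sup>2 / 2 * W" by (simp add: algebra_simps)
  ultimately show ?thesis by linarith
qed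

section \<open>Regret and final queue length\<close>

text \<open>The inequality for one round compares \<open>x t\<close> with \<open>x (Suc t)\<close>
  and so covers rounds before \<open>T\<close> only; the last loss difference is bounded
  separately.\<close>

lemma regret_split:
  "regret f T xstar x = (\<Sum>t\<in>{1..<T}. f t (x t) - f t (xstar t)) + (f T (x T) - f T (xstar T))"
proof -
  have "{1..T} = insert T {1..<T}" using T_ge by auto
  then show ?thesis by (simp add: regret_def sum_subtractf)
qed

lemma loss_difference_bound: "t \<in> {1..T} \<Longrightarrow> \<bar>f t (x t) - f t (xstar t)\<bar> \<le> 2 * F"
  using f_bound[OF _ x_in_X, of t t] f_bound[OF _ xstar_in_X, of t t] by auto

lemma regret_le:
  "regret f T xstar x \<le> 2 * F + (7 * R + G\<^sup>2 / 2) * W + (\<Sum>t\<in>{1..<T}. scaled_change t) + (\<gamma> 0 * F)\<^sup>2 / 2"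
proof -
  have "f T (x T) - f T (xstar T) \<le> 2 * F" using loss_difference_bound[of T] T_ge by auto
  moreover have "(norm (Q T))\<^sup>2 / 2 \<ge> 0" by simp
  ultimately show ?thesis using sum_loss_plus_queue_le unfolding regret_split by linarith
qed

text \<open>A crude bound free of the constraint variation. It suffices for the queue, and for the
  regret under the decaying schedule.\<close>

lemma scaled_change_le:
  assumes "t \<in> {1..<T}"
  shows "scaled_change t \<le> 4 * F\<^sup>2 * (\<gamma> (t - 1))\<^sup>2"
proof -
  have xt: "x t \<in> X" using x_in_X assms by auto
  have "norm (\<gamma> t *\<^sub>R g t (x t) - \<gamma> (t - 1) *\<^sub>R g (t - 1) (x t))
      \<le> \<gamma> t * norm (g t (x t)) + \<gamma> (t - 1) * norm (g (t - 1) (x t))"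
    using norm_triangle_ineq4[of "\<gamma> t *\<^sub>R g t (x t)" "\<gamma> (t - 1) *\<^sub>R g (t - 1) (x t)"]
      gamma_pos[of t] gamma_pos[of "t - 1"] by simp
  also have "\<dots> \<le> \<gamma> (t - 1) * F + \<gamma> (t - 1) * F"
    using g_bound'[OF _ xt, of t] g_bound'[OF _ xt, of "t - 1"] gamma_mono[of "t - 1" t] assms
      gamma_pos[of t] gamma_pos[of "t - 1"]
    by (intro add_mono mult_mono) auto
  finally have "scaled_change t \<le> (\<gamma> (t - 1) * F + \<gamma> (t - 1) * F)\<^sup>2"
    unfolding scaled_change_def by (intro power_mono) auto
  then show ?thesis by (simp add: power2_eq_square algebra_simps)
qed

lemma W_le: "W \<le> sqrt (2 * R) * real T"
proof -
  have "R + S T \<le> R * real T" using S_bound[of T] T_ge by auto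
  then have "real T * (R + S T) \<le> real T * (R * real T)" by (intro mult_left_mono) auto
  also have "\<dots> = R * (real T)\<^sup>2" by (simp add: power2_eq_square)
  also have "\<dots> \<le> (2 * R) * (real T)\<^sup>2" using R_pos by (intro mult_right_mono) auto
  finally have "W \<le> sqrt ((2 * R) * (real T)\<^sup>2)" unfolding W_def S_T[symmetric] by simp
  then show ?thesis by (simp add: real_sqrt_mult)
qed

text \<open>Each loss difference is at least \<open>- 2 * F\<close> and \<open>W\<close> is at most
  linear in \<open>T\<close>, so the summed inequality bounds the squared norm by a multiple of
  \<open>T\<close>.\<close>

lemma norm_queue_le: "norm (Q T) \<le> queue_const R F G (\<gamma> 0) * sqrt (real T)"
proof -
  have "- (2 * F * real T) \<le> (\<Sum>t\<in>{1..<T}. f t (x t) - f t (xstar t))"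
  proof -
    have "(\<Sum>t\<in>{1..<T}. - (2 * F)) \<le> (\<Sum>t\<in>{1..<T}. f t (x t) - f t (xstar t))"
      using loss_difference_bound by (intro sum_mono) (force simp: abs_le_iff)
    moreover have "- (2 * F * real T) \<le> (\<Sum>t\<in>{1..<T}. - (2 * F))"
      using F_nonneg T_ge by (simp add: mult_right_mono algebra_simps)
    ultimately show ?thesis by linarith
  qed
  moreover have "(7 * R + G\<^sup>2 / 2) * W \<le> (7 * R + G\<^sup>2 / 2) * (sqrt (2 * R) * real T)"
    using W_le R_pos by (intro mult_left_mono) auto
  moreover have "(\<Sum>t\<in>{1..<T}. scaled_change t) \<le> 4 * (\<gamma> 0 * F)\<^sup>2 * real T"
  proof -
    have "scaled_change t \<le> 4 * (\<gamma> 0 * F)\<^sup>2" if "t \<in> {1..<T}" for t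
    proof -
      have "(\<gamma> (t - 1))\<^sup>2 \<le> (\<gamma> 0)\<^sup>2"
        using gamma_mono[of 0 "t - 1"] gamma_pos[of "t - 1"] by (intro power_mono) auto
      then have "4 * F\<^sup>2 * (\<gamma> (t - 1))\<^sup>2 \<le> 4 * F\<^sup>2 * (\<gamma> 0)\<^sup>2" by (intro mult_left_mono) auto
      then show ?thesis using scaled_change_le[OF that] by (simp add: power_mult_distrib mult_ac)
    qed
    then have "(\<Sum>t\<in>{1..<T}. scaled_change t) \<le> (\<Sum>t\<in>{1..<T}. 4 * (\<gamma> 0 * F)\<^sup>2)"
      by (rule sum_mono)
    also have "\<dots> \<le> real T * (4 * (\<gamma> 0 * F)\<^sup>2)"
      by (simp only: sum_constant card_atLeastLessThan, intro mult_right_mono) auto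
    finally show ?thesis by (simp add: mult_ac)
  qed
  moreover have "(\<gamma> 0 * F)\<^sup>2 / 2 \<le> (\<gamma> 0 * F)\<^sup>2 / 2 * real T"
    using T_ge mult_left_mono[of 1 "real T" "(\<gamma> 0 * F)\<^sup>2 / 2"] by simp
  ultimately have "(norm (Q T))\<^sup>2
      \<le> (4 * F + 2 * ((7 * R + G\<^sup>2 / 2) * sqrt (2 * R)) + 9 * (\<gamma> 0 * F)\<^sup>2) * real T"
    using sum_loss_plus_queue_le by (simp add: algebra_simps)
  then have "norm (Q T)
      \<le> sqrt ((4 * F + 2 * ((7 * R + G\<^sup>2 / 2) * sqrt (2 * R)) + 9 * (\<gamma> 0 * F)\<^sup>2) * real T)"
    by (rule real_le_rsqrt)
  then show ?thesis by (simp add: queue_const_def real_sqrt_mult)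
qed

section \<open>Constraint variation and violations\<close>

text \<open>The bound \<open>F + F\<close> on the differences makes the real supremum an upper
  bound.\<close>

lemma constraint_change_le:
  assumes t: "t \<in> {2..T}" and y: "y \<in> X"
  shows "norm (g t y - g (t - 1) y) \<le> (SUP y\<in>X. norm (g t y - g (t - 1) y))"
proof (rule cSUP_upper[OF y], rule bdd_aboveI2)
  fix z assume z: "z \<in> X"
  have t': "t - 1 \<le> T" "t \<le> T" using t by auto
  show "norm (g t z - g (t - 1) z) \<le> F + F"
    using norm_triangle_ineq4[of "g t z" "g (t - 1) z"] g_bound'[OF t'(1) z] g_bound'[OF t'(2) z]
    by linarith
qed

lemma sum_constraint_change_le:
  "(\<Sum>t=2..T. norm (g t (x t) - g (t - 1) (x t))) \<le> constraint_variation X g T"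
  unfolding constraint_variation_def
  by (rule sum_mono) (use constraint_change_le x_in_X in auto)

lemma constraint_variation_nonneg: "constraint_variation X g T \<ge> 0"
  using sum_constraint_change_le
    sum_nonneg[of "{2..T}" "\<lambda>t. norm (g t (x t) - g (t - 1) (x t))"] by simp

text \<open>Works because \<open>1 / \<gamma>\<^sub>t\<close> is increasing and the queue is nonnegative.\<close>

lemma sum_past_constraint_le: "(\<Sum>t\<in>{1..n}. g t (x (Suc t)) $ k) \<le> Q (Suc n) $ k / \<gamma> n"
proof (induction n)
  case 0
  then show ?case using queue_1 by simp
next
  case (Suc n)
  have "Q (Suc n) $ k / \<gamma> n \<le> Q (Suc n) $ k / \<gamma> (Suc n)"
    using gamma_decreasing[of n] gamma_pos[of n] gamma_pos[of "Suc n"] queue_nonneg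
    by (intro divide_left_mono) (auto simp del: queue.simps)
  moreover have "Q (Suc n) $ k / \<gamma> (Suc n) + g (Suc n) (x (Suc (Suc n))) $ k
      \<le> Q (Suc (Suc n)) $ k / \<gamma> (Suc n)"
  proof -
    have "Q (Suc n) $ k + \<gamma> (Suc n) * g (Suc n) (x (Suc (Suc n))) $ k \<le> Q (Suc (Suc n)) $ k"
      by (simp del: queue.simps(2) add: queue.simps(2)[of \<gamma> g x "Suc n"])
    then have "(Q (Suc n) $ k + \<gamma> (Suc n) * g (Suc n) (x (Suc (Suc n))) $ k) / \<gamma> (Suc n)
        \<le> Q (Suc (Suc n)) $ k / \<gamma> (Suc n)"
      using gamma_pos[of "Suc n"] by (intro divide_right_mono) auto
    then show ?thesis using gamma_pos[of "Suc n"] by (simp add: add_divide_distrib)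
  qed
  ultimately show ?case using Suc by (simp del: queue.simps)
qed

text \<open>The queue records \<open>g (t - 1) (x t)\<close>, the previous constraint at the new
  point. Passing to \<open>g t\<close> costs the constraint variation, and the first round costs at
  most \<open>F\<close>.\<close>

lemma violation_le:
  "violation g T x k \<le> F + constraint_variation X g T + queue_const R F G (\<gamma> 0) * sqrt (real T) / \<gamma> (T - 1)"
proof -
  have "violation g T x k = g 1 (x 1) $ k + (\<Sum>t=2..T. g t (x t) $ k)"
    unfolding violation_def
    using sum.atLeast_Suc_atMost[OF T_ge, of "\<lambda>t. g t (x t) $ k"] by (simp add: numeral_2_eq_2)
  moreover have "g 1 (x 1) $ k \<le> F"
    using component_le_norm_cart[of "g 1 (x 1)" k] g_bound[OF _ x_in_X, of 1 1] T_ge by auto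
  moreover have "(\<Sum>t=2..T. g t (x t) $ k)
      \<le> (\<Sum>t=2..T. norm (g t (x t) - g (t - 1) (x t)) + g (t - 1) (x t) $ k)"
  proof (rule sum_mono)
    fix t
    show "g t (x t) $ k \<le> norm (g t (x t) - g (t - 1) (x t)) + g (t - 1) (x t) $ k"
      using component_le_norm_cart[of "g t (x t) - g (t - 1) (x t)" k] by simp
  qed
  moreover have "(\<Sum>t=2..T. g (t - 1) (x t) $ k) \<le> queue_const R F G (\<gamma> 0) * sqrt (real T) / \<gamma> (T - 1)"
  proof -
    have "(\<Sum>t=2..T. g (t - 1) (x t) $ k) = (\<Sum>t=1..T - 1. g t (x (Suc t)) $ k)"
      using sum.shift_bounds_cl_Suc_ivl[of "\<lambda>t. g (t - 1) (x t) $ k" 1 "T - 1"] T_ge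
      by (simp add: numeral_2_eq_2)
    also have "\<dots> \<le> Q T $ k / \<gamma> (T - 1)"
      using sum_past_constraint_le[of k "T - 1"] T_ge by simp
    also have "\<dots> \<le> queue_const R F G (\<gamma> 0) * sqrt (real T) / \<gamma> (T - 1)"
      using component_le_norm_cart[of "Q T" k] norm_queue_le gamma_pos[of "T - 1"]
      by (intro divide_right_mono) auto
    finally show ?thesis .
  qed
  ultimately show ?thesis using sum_constraint_change_le by (simp add: sum.distrib)
qed

section \<open>The two schedules for \<gamma>\<close>

text \<open>A change \<open>m\<close> of the constraint satisfies \<open>m \<le> 2 * F\<close>, so
  its square is at most \<open>2 * F * m\<close> and sums to a multiple of the variation. Round 1
  compares with \<open>g 0 = 0\<close>, a jump outside the variation, and contributes
  \<open>(c * F)^2\<close>.\<close>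

lemma sum_scaled_change_const:
  assumes "\<And>t. \<gamma> t = c"
  shows "(\<Sum>t\<in>{1..<T}. scaled_change t) \<le> (c * F)\<^sup>2 + 2 * c\<^sup>2 * F * constraint_variation X g T"
proof (cases "T = 1")
  case True
  then show ?thesis using F_nonneg constraint_variation_nonneg by simp
next
  case False
  then have T: "1 < T" using T_ge by simp
  have eq: "scaled_change t = c\<^sup>2 * (norm (g t (x t) - g (t - 1) (x t)))\<^sup>2" for t
    by (simp add: scaled_change_def assms power_mult_distrib flip: scaleR_diff_right)
  have "scaled_change 1 \<le> (c * F)\<^sup>2"
    using g_bound[OF _ x_in_X, of 1 1] T F_nonneg
    by (simp add: eq g_0 power_mult_distrib mult_left_mono power_mono)
  moreover have "(\<Sum>t\<in>{2..<T}. scaled_change t) \<le> 2 * c\<^sup>2 * F * constraint_variation X g T"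
  proof -
    have "(\<Sum>t\<in>{2..<T}. scaled_change t)
        \<le> (\<Sum>t\<in>{2..<T}. 2 * c\<^sup>2 * F * norm (g t (x t) - g (t - 1) (x t)))"
    proof (rule sum_mono)
      fix t assume t: "t \<in> {2..<T}"
      then have t': "t - 1 \<le> T" "t \<le> T" and xt: "x t \<in> X" using x_in_X by auto
      define m where "m = norm (g t (x t) - g (t - 1) (x t))"
      have "m \<le> 2 * F" using norm_triangle_ineq4[of "g t (x t)" "g (t - 1) (x t)"]
          g_bound'[OF t'(1) xt] g_bound'[OF t'(2) xt] unfolding m_def by linarith
      then have "m * m \<le> 2 * F * m" by (intro mult_right_mono) (auto simp: m_def)
      then have "c\<^sup>2 * (m * m) \<le> c\<^sup>2 * (2 * F * m)" by (intro mult_left_mono) auto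
      then show "scaled_change t \<le> 2 * c\<^sup>2 * F * norm (g t (x t) - g (t - 1) (x t))"
        unfolding eq m_def[symmetric] by (simp add: power2_eq_square mult_ac)
    qed
    also have "\<dots> = 2 * c\<^sup>2 * F * (\<Sum>t\<in>{2..<T}. norm (g t (x t) - g (t - 1) (x t)))"
      by (simp add: sum_distrib_left)
    also have "\<dots> \<le> 2 * c\<^sup>2 * F * (\<Sum>t=2..T. norm (g t (x t) - g (t - 1) (x t)))"
      using F_nonneg by (intro mult_left_mono sum_mono2) auto
    also have "\<dots> \<le> 2 * c\<^sup>2 * F * constraint_variation X g T"
      using F_nonneg sum_constraint_change_le by (intro mult_left_mono) auto
    finally show ?thesis .
  qed
  moreover have "(\<Sum>t\<in>{1..<T}. scaled_change t) = scaled_change 1 + (\<Sum>t\<in>{2..<T}. scaled_change t)"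
    using sum.atLeast_Suc_lessThan[OF T] by (simp add: numeral_2_eq_2)
  ultimately show ?thesis by simp
qed

text \<open>The crude bound involves \<open>\<gamma> (t - 1)\<close>, whose square is
  \<open>c^2 / sqrt t\<close>; the sum is of order \<open>sqrt T\<close>, and the constraint
  variation does not appear.\<close>

lemma sum_scaled_change_decay:
  assumes "\<And>t. (\<gamma> t)\<^sup>2 = c\<^sup>2 * (1 / sqrt (real t + 1))"
  shows "(\<Sum>t\<in>{1..<T}. scaled_change t) \<le> 8 * (c * F)\<^sup>2 * sqrt (real T)"
proof -
  have "(\<Sum>t\<in>{1..<T}. scaled_change t) \<le> (\<Sum>t\<in>{1..<T}. 4 * (c * F)\<^sup>2 * (1 / sqrt (real t)))"
  proof (rule sum_mono)
    fix t assume t: "t \<in> {1..<T}"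
    then have "(\<gamma> (t - 1))\<^sup>2 = c\<^sup>2 * (1 / sqrt (real t))"
      using assms[of "t - 1"] by (simp add: of_nat_diff)
    then show "scaled_change t \<le> 4 * (c * F)\<^sup>2 * (1 / sqrt (real t))"
      using scaled_change_le[OF t] by (simp add: power_mult_distrib mult_ac)
  qed
  also have "\<dots> \<le> (\<Sum>t=1..T. 4 * (c * F)\<^sup>2 * (1 / sqrt (real t)))"
    by (intro sum_mono2) auto
  also have "\<dots> = 4 * (c * F)\<^sup>2 * (\<Sum>t=1..T. 1 / sqrt (real t))"
    by (simp add: sum_distrib_left)
  also have "\<dots> \<le> 4 * (c * F)\<^sup>2 * (2 * sqrt (real T))"
    using sum_inverse_sqrt_le by (intro mult_left_mono) auto
  finally show ?thesis by simp
qed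

section \<open>The final bounds\<close>

lemma W_le_max: "W \<le> 2 * sqrt (real T * max R (path_variation T xstar))"
proof -
  \<comment> \<open>A factor 2 is rounded up to 4, whose root is rational.\<close>
  have "real T * (R + path_variation T xstar) \<le> real T * (4 * max R (path_variation T xstar))"
    using R_pos by (intro mult_left_mono) auto
  then have "W \<le> sqrt (4 * (real T * max R (path_variation T xstar)))"
    unfolding W_def by (intro real_sqrt_le_mono) (simp add: mult_ac)
  then show ?thesis by (simp add: real_sqrt_mult)
qed

text \<open>This is the benefit of the floor \<open>R\<close>: terms of order \<open>sqrt T\<close>,
  and with them constants, are absorbed even if the path variation is 0.\<close>

lemma sqrt_T_le: "sqrt (real T) \<le> sqrt (real T * max R (path_variation T xstar)) / sqrt R"
proof -
  have "sqrt (real T) * sqrt R \<le> sqrt (real T * max R (path_variation T xstar))"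
    unfolding real_sqrt_mult[symmetric] by (intro real_sqrt_le_mono mult_left_mono) auto
  then show ?thesis using R_pos by (simp add: field_simps)
qed

lemma const_le:
  "0 \<le> a \<Longrightarrow> a \<le> a / sqrt R * sqrt (real T * max R (path_variation T xstar))"
  using mult_left_mono[OF sqrt_T_le, of a] mult_left_mono[of 1 "sqrt (real T)" a] T_ge by simp

lemma queue_const_nonneg: "queue_const R F G c \<ge> 0"
  using F_nonneg R_pos by (simp add: queue_const_def)

lemma regret_const:
  assumes "\<And>t. \<gamma> t = \<gamma> 0"
  shows "regret f T xstar x \<le> bound_const R F G (\<gamma> 0) *
    max (sqrt (real T * max R (path_variation T xstar))) (constraint_variation X g T)"
proof -
  define Z where "Z = sqrt (real T * max R (path_variation T xstar))"
  define m where "m = max Z (constraint_variation X g T)"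
  define b where "b = (2 * F + 9 * (\<gamma> 0 * F)\<^sup>2) / sqrt R"
  have m: "Z \<le> m" "constraint_variation X g T \<le> m" "0 \<le> m"
    using constraint_variation_nonneg by (auto simp: m_def)
  have b: "b \<ge> 0" using F_nonneg R_pos by (simp add: b_def)
  have "2 * F + 9 * (\<gamma> 0 * F)\<^sup>2 \<le> b * Z"
    unfolding Z_def b_def using F_nonneg by (intro const_le) simp
  also have "\<dots> \<le> b * m" using b m by (intro mult_left_mono) auto
  finally have 1: "2 * F + 9 * (\<gamma> 0 * F)\<^sup>2 \<le> b * m" .
  have "W \<le> 2 * m" using W_le_max m unfolding Z_def by linarith
  then have 2: "(7 * R + G\<^sup>2 / 2) * W \<le> (7 * R + G\<^sup>2 / 2) * (2 * m)"
    using R_pos by (intro mult_left_mono) auto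
  have 3: "2 * (\<gamma> 0)\<^sup>2 * F * constraint_variation X g T \<le> 2 * (\<gamma> 0)\<^sup>2 * F * m"
    using F_nonneg m by (intro mult_left_mono) auto
  \<comment> \<open>The summands of \<open>bound_const\<close> that the regret does not produce,
    added as nonnegative slack.\<close>
  have 4: "0 \<le> (F + 1 + queue_const R F G (\<gamma> 0) / \<gamma> 0) * m"
    using F_nonneg queue_const_nonneg[of "\<gamma> 0"] gamma_pos[of 0] m by simp
  have "(\<gamma> 0 * F)\<^sup>2 \<ge> 0" by simp
  then have "regret f T xstar x
      \<le> b * m + (7 * R + G\<^sup>2 / 2) * (2 * m) + 2 * (\<gamma> 0)\<^sup>2 * F * m + (F + 1 + queue_const R F G (\<gamma> 0) / \<gamma> 0) * m"
    using regret_le sum_scaled_change_const[OF assms] 1 2 3 4 by linarith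
  also have "\<dots> = bound_const R F G (\<gamma> 0) * m"
    unfolding bound_const_def b_def[symmetric] by (simp add: algebra_simps)
  finally show ?thesis by (simp add: m_def Z_def)
qed

lemma regret_decay:
  assumes "\<And>t. (\<gamma> t)\<^sup>2 = (\<gamma> 0)\<^sup>2 * (1 / sqrt (real t + 1))"
  shows "regret f T xstar x \<le> bound_const R F G (\<gamma> 0) *
    sqrt (real T * max R (path_variation T xstar))"
proof -
  define Z where "Z = sqrt (real T * max R (path_variation T xstar))"
  have Z: "Z \<ge> 0" using R_pos by (simp add: Z_def)
  have 1: "2 * F + (\<gamma> 0 * F)\<^sup>2 \<le> (2 * F + (\<gamma> 0 * F)\<^sup>2) / sqrt R * Z"
    unfolding Z_def using F_nonneg by (intro const_le) simp
  have 2: "(7 * R + G\<^sup>2 / 2) * W \<le> (7 * R + G\<^sup>2 / 2) * (2 * Z)"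
    using R_pos W_le_max unfolding Z_def by (intro mult_left_mono) auto
  have 3: "8 * (\<gamma> 0 * F)\<^sup>2 * sqrt (real T) \<le> 8 * (\<gamma> 0 * F)\<^sup>2 * (Z / sqrt R)"
    unfolding Z_def using sqrt_T_le by (intro mult_left_mono) auto
  have 4: "0 \<le> (2 * (\<gamma> 0)\<^sup>2 * F + F + 1 + queue_const R F G (\<gamma> 0) / \<gamma> 0) * Z"
    using F_nonneg queue_const_nonneg[of "\<gamma> 0"] gamma_pos[of 0] Z by simp
  have "(\<gamma> 0 * F)\<^sup>2 \<ge> 0" by simp
  then have "regret f T xstar x
      \<le> (2 * F + (\<gamma> 0 * F)\<^sup>2) / sqrt R * Z + (7 * R + G\<^sup>2 / 2) * (2 * Z)
        + 8 * (\<gamma> 0 * F)\<^sup>2 * (Z / sqrt R)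
        + (2 * (\<gamma> 0)\<^sup>2 * F + F + 1 + queue_const R F G (\<gamma> 0) / \<gamma> 0) * Z"
    using regret_le sum_scaled_change_decay[OF assms] 1 2 3 4 by linarith
  also have "\<dots> = bound_const R F G (\<gamma> 0) * Z"
    by (simp add: bound_const_def algebra_simps add_divide_distrib)
  finally show ?thesis by (simp add: Z_def)
qed

text \<open>Here \<open>r\<close> is the growth rate, \<open>sqrt T\<close> or
  \<open>T powr (3 / 4)\<close>; the second assumption measures how much dividing the queue bound by
  the last \<gamma> costs.\<close>

lemma violation_le_max:
  assumes "1 \<le> r" and "sqrt (real T) / \<gamma> (T - 1) \<le> r / \<gamma> 0"
  shows "violation g T x k \<le> bound_const R F G (\<gamma> 0) * max r (constraint_variation X g T)"
proof -
  define m where "m = max r (constraint_variation X g T)"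
  have m: "r \<le> m" "constraint_variation X g T \<le> m" "1 \<le> m" using assms by (auto simp: m_def)
  have "F \<le> F * m" using F_nonneg m mult_left_mono[of 1 m F] by simp
  moreover have "queue_const R F G (\<gamma> 0) * (sqrt (real T) / \<gamma> (T - 1))
      \<le> queue_const R F G (\<gamma> 0) * (m / \<gamma> 0)"
    using assms(2) m gamma_pos[of 0] divide_right_mono[of r m "\<gamma> 0"] queue_const_nonneg
    by (intro mult_left_mono) auto
  moreover have "0 \<le> ((2 * F + 9 * (\<gamma> 0 * F)\<^sup>2) / sqrt R + 2 * (7 * R + G\<^sup>2 / 2) + 2 * (\<gamma> 0)\<^sup>2 * F) * m"
    using F_nonneg R_pos m by simp
  ultimately have "violation g T x k
      \<le> F * m + m + queue_const R F G (\<gamma> 0) * (m / \<gamma> 0)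
        + ((2 * F + 9 * (\<gamma> 0 * F)\<^sup>2) / sqrt R + 2 * (7 * R + G\<^sup>2 / 2) + 2 * (\<gamma> 0)\<^sup>2 * F) * m"
    using violation_le[of k] m by (simp only: times_divide_eq_right)
  also have "\<dots> = bound_const R F G (\<gamma> 0) * m"
    by (simp add: bound_const_def algebra_simps)
  finally show ?thesis by (simp add: m_def)
qed

lemma violation_const:
  assumes "\<And>t. \<gamma> t = \<gamma> 0"
  shows "violation g T x k \<le> bound_const R F G (\<gamma> 0) * max (sqrt (real T)) (constraint_variation X g T)"
  using T_ge assms[of "T - 1"] by (intro violation_le_max) auto

text \<open>The last parameter \<open>\<gamma> (T - 1)\<close> is \<open>\<gamma> 0\<close> divided
  by the fourth root \<open>p\<close> of \<open>T\<close>, so the queue bound of order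
  \<open>p^2\<close> turns into \<open>p^3\<close>.\<close>

lemma violation_decay:
  assumes "\<And>t. (\<gamma> t)\<^sup>2 = (\<gamma> 0)\<^sup>2 * (1 / sqrt (real t + 1))"
  shows "violation g T x k
    \<le> bound_const R F G (\<gamma> 0) * max (real T powr (3 / 4)) (constraint_variation X g T)"
proof (rule violation_le_max)
  show "1 \<le> real T powr (3 / 4)" using T_ge by (intro ge_one_powr_ge_zero) auto
  define p where "p = real T powr (1 / 4)"
  have p: "p > 0" using T_ge by (simp add: p_def)
  have half: "sqrt (real T) = p\<^sup>2"
    using T_ge by (simp add: p_def powr_half_sqrt[symmetric] powr_powr flip: powr_realpow)
  have cube: "real T powr (3 / 4) = p\<^sup>2 * p"
    using T_ge by (simp add: p_def powr_powr power2_eq_square flip: powr_add)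
  have "(\<gamma> (T - 1) * p)\<^sup>2 = (\<gamma> 0)\<^sup>2"
    using assms[of "T - 1"] T_ge p half by (simp add: power_mult_distrib of_nat_diff)
  then have "\<gamma> (T - 1) * p = \<gamma> 0"
    using gamma_pos[of "T - 1"] gamma_pos[of 0] p by (simp add: power2_eq_iff_nonneg less_imp_le)
  then have "sqrt (real T) / \<gamma> (T - 1) = real T powr (3 / 4) / \<gamma> 0"
    unfolding half cube using p by (simp flip: \<open>\<gamma> (T - 1) * p = \<gamma> 0\<close>)
  then show "sqrt (real T) / \<gamma> (T - 1) \<le> real T powr (3 / 4) / \<gamma> 0" by simp
qed

end

(* The floor R on the path variation: with V_x = V_g = 0 (say f_t x = x and g_t = 0 on [0,1],
   x_1 = 1) the regret is positive, so a multiple of max (sqrt (T V_x)) V_g cannot bound it. *)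
theorem theorem1:
  fixes R F G :: real
  assumes "R > 0" and "G > 0"
  shows "\<exists>C. \<forall>(X :: 'a::real_inner set) f df (g :: nat \<Rightarrow> 'a \<Rightarrow> real ^ 'k) dg xstar \<alpha> \<gamma> lam x T.
    let \<beta> = real CARD('k) * G;
        Vx = path_variation T xstar;
        Vg = constraint_variation X g T
    in
    T \<ge> 1 \<and> online_problem X g T \<and> standing_assumptions R F G X f df g dg T \<and>
    slot_minimizers X f g T xstar \<and> xstar 0 = xstar 1 \<and>
    vqb_run X df g \<alpha> \<gamma> T lam x \<and>
    (\<forall>t\<in>{1..T}. \<alpha> t = sqrt (real T / (R + (\<Sum>i=1..t. norm (xstar i - xstar (i - 1)))))) \<and>
    (\<forall>t. \<gamma> t > 0)
    \<longrightarrow>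
    ((\<forall>t. (\<gamma> t)\<^sup>2 = 1 / (2 * \<beta>\<^sup>2) * (1 / sqrt (2 * R))) \<longrightarrow>
       regret f T xstar x \<le> C * max (sqrt (real T * max R Vx)) Vg \<and>
       (\<forall>k. violation g T x k \<le> C * max (sqrt (real T)) Vg)) \<and>
    ((\<forall>t. (\<gamma> t)\<^sup>2 = 1 / (2 * \<beta>\<^sup>2) * (1 / sqrt (2 * R)) * (1 / sqrt (real t + 1))) \<longrightarrow>
       regret f T xstar x \<le> C * sqrt (real T * max R Vx) \<and>
       (\<forall>k. violation g T x k \<le> C * max (real T powr (3 / 4)) Vg))"
proof -
  \<comment> \<open>The value of \<gamma> in the first case and of \<open>\<gamma> 0\<close> in the
    second. It depends on \<open>R\<close>, \<open>G\<close> and \<open>CARD('k)\<close> only, so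
    \<open>bound_const R F G c\<close> is uniform over all instances and horizons.\<close>
  define c where "c = sqrt (1 / (2 * (real CARD('k) * G)\<^sup>2) * (1 / sqrt (2 * R)))"
  have c2: "c\<^sup>2 = 1 / (2 * (real CARD('k) * G)\<^sup>2) * (1 / sqrt (2 * R))"
    using \<open>R > 0\<close> by (simp add: c_def)
  have "c \<ge> 0" using \<open>R > 0\<close> by (simp add: c_def)
  have \<beta>: "(real CARD('k) * G)\<^sup>2 > 0" using \<open>G > 0\<close> by simp
  \<comment> \<open>The left side equals \<open>1 / sqrt (2 * R)\<close>.\<close>
  have step: "2 * (real CARD('k) * G)\<^sup>2 * c\<^sup>2 \<le> 1 / sqrt R"
    unfolding c2 using \<beta> \<open>R > 0\<close> by (simp add: frac_le)
  show ?thesis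
    unfolding Let_def
  proof (intro exI[of _ "bound_const R F G c"] allI impI)
    fix X :: "'a set" and f df and g :: "nat \<Rightarrow> 'a \<Rightarrow> real ^ 'k" and dg xstar \<alpha> \<gamma> lam x T
    assume A: "T \<ge> 1 \<and> online_problem X g T \<and> standing_assumptions R F G X f df g dg T \<and>
      slot_minimizers X f g T xstar \<and> xstar 0 = xstar 1 \<and>
      vqb_run X df g \<alpha> \<gamma> T lam x \<and>
      (\<forall>t\<in>{1..T}. \<alpha> t = sqrt (real T / (R + (\<Sum>i=1..t. norm (xstar i - xstar (i - 1)))))) \<and>
      (\<forall>t. \<gamma> t > 0)"
    \<comment> \<open>Both schedules enter the common setting through monotonicity and the bound
      \<open>c\<close>.\<close>
    have inst: "vqb_instance R F G X f df g dg xstar \<alpha> \<gamma> lam x T"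
      if "\<And>t. \<gamma> (Suc t) \<le> \<gamma> t" and "\<And>t. \<gamma> t \<le> c"
    proof (unfold_locales; (use A \<open>R > 0\<close> that(1) in auto)?)
      fix t
      have "(\<gamma> t)\<^sup>2 \<le> c\<^sup>2" using A that(2) by (intro power_mono) (auto simp: less_imp_le)
      then have "2 * (real CARD('k) * G)\<^sup>2 * (\<gamma> t)\<^sup>2 \<le> 2 * (real CARD('k) * G)\<^sup>2 * c\<^sup>2"
        by (intro mult_left_mono) auto
      then show "2 * (real CARD('k) * G)\<^sup>2 * (\<gamma> t)\<^sup>2 \<le> 1 / sqrt R" using step by linarith
    qed
    show "((\<forall>t. (\<gamma> t)\<^sup>2 = 1 / (2 * (real CARD('k) * G)\<^sup>2) * (1 / sqrt (2 * R))) \<longrightarrow>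
        regret f T xstar x \<le> bound_const R F G c *
          max (sqrt (real T * max R (path_variation T xstar))) (constraint_variation X g T) \<and>
        (\<forall>k. violation g T x k
          \<le> bound_const R F G c * max (sqrt (real T)) (constraint_variation X g T))) \<and>
      ((\<forall>t. (\<gamma> t)\<^sup>2 = 1 / (2 * (real CARD('k) * G)\<^sup>2) * (1 / sqrt (2 * R)) * (1 / sqrt (real t + 1))) \<longrightarrow>
        regret f T xstar x \<le> bound_const R F G c * sqrt (real T * max R (path_variation T xstar)) \<and>
        (\<forall>k. violation g T x k
          \<le> bound_const R F G c * max (real T powr (3 / 4)) (constraint_variation X g T)))"
      unfolding c2[symmetric]
    proof (rule conjI; rule impI)
      assume sq: "\<forall>t. (\<gamma> t)\<^sup>2 = c\<^sup>2"
      have \<gamma>: "\<gamma> t = c" for t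
        using sq A \<open>c \<ge> 0\<close> by (meson less_imp_le power2_eq_iff_nonneg)
      interpret vqb_instance R F G X f df g dg xstar \<alpha> \<gamma> lam x T
        by (rule inst) (simp_all add: \<gamma>)
      show "regret f T xstar x \<le> bound_const R F G c *
          max (sqrt (real T * max R (path_variation T xstar))) (constraint_variation X g T) \<and>
        (\<forall>k. violation g T x k
          \<le> bound_const R F G c * max (sqrt (real T)) (constraint_variation X g T))"
        using regret_const violation_const by (simp add: \<gamma>)
    next
      assume sq: "\<forall>t. (\<gamma> t)\<^sup>2 = c\<^sup>2 * (1 / sqrt (real t + 1))"
      then have "(\<gamma> 0)\<^sup>2 = c\<^sup>2" by simp
      then have \<gamma>0: "\<gamma> 0 = c"
        using A \<open>c \<ge> 0\<close> by (meson less_imp_le power2_eq_iff_nonneg)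
      have anti: "\<gamma> t \<le> \<gamma> s" if "s \<le> t" for s t
      proof (rule power2_le_imp_le)
        have "1 / sqrt (real t + 1) \<le> 1 / sqrt (real s + 1)"
          using that by (intro divide_left_mono) auto
        then show "(\<gamma> t)\<^sup>2 \<le> (\<gamma> s)\<^sup>2"
          unfolding sq[rule_format] by (intro mult_left_mono) auto
        show "0 \<le> \<gamma> s" using A by (simp add: less_imp_le)
      qed
      interpret vqb_instance R F G X f df g dg xstar \<alpha> \<gamma> lam x T
        using anti[of 0] by (intro inst anti) (simp_all add: \<gamma>0)
      show "regret f T xstar x \<le> bound_const R F G c * sqrt (real T * max R (path_variation T xstar)) \<and>
        (\<forall>k. violation g T x k
          \<le> bound_const R F G c * max (real T powr (3 / 4)) (constraint_variation X g T))"
        using regret_decay violation_decay sq by (simp add: \<gamma>0)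
    qed
  qed
qed

end
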